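(* For every $n\ge 3$, $T_n(n)=0$ and $T_n\bigl((n-1)^2-1\bigr)=0$.
   Context: $[n]=\{1,\dots,n\}$. An order-$n$ Latin square is an $n\times n$ matrix $L=(L(i,j))_{1\le i,j\le n}$ with entries in $[n]$ such that every row and every column is a permutation of $[n]$. For $1\le j\le n$, $k_j(L)$ is the number of ascents of the $j$-th column, i.e. the number of indices $i\in\{1,\dots,n-1\}$ with $L(i,j)<L(i+1,j)$. The total ascent statistic is $\Sigma(L)=\sum_{j=1}^n k_j(L)$, and $T_n(m)$ is the number of order-$n$ Latin squares $L$ with $\Sigma(L)=m$. *)

theory Defs
  imports Complex_Main "HOL-Library.FuncSet"
begin

text \<open>Matrices are extensional (\<^const>\<open>PiE\<close>) so that each Latin square is represented by exactly
  one function and the squares of a given order form a finite set.\<close>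

definition latin_squares :: "nat \<Rightarrow> (nat \<Rightarrow> nat \<Rightarrow> nat) set" where
  "latin_squares n =
     {L \<in> {1..n} \<rightarrow>\<^sub>E ({1..n} \<rightarrow>\<^sub>E {1..n}).
        (\<forall>i\<in>{1..n}. bij_betw (\<lambda>j. L i j) {1..n} {1..n}) \<and>
        (\<forall>j\<in>{1..n}. bij_betw (\<lambda>i. L i j) {1..n} {1..n})}"

definition column_ascents :: "nat \<Rightarrow> (nat \<Rightarrow> nat \<Rightarrow> nat) \<Rightarrow> nat \<Rightarrow> nat" where
  "column_ascents n L j = card {i \<in> {1..n - 1}. L i j < L (i + 1) j}"

definition total_ascents :: "nat \<Rightarrow> (nat \<Rightarrow> nat \<Rightarrow> nat) \<Rightarrow> nat" where
  "total_ascents n L = (\<Sum>j = 1..n. column_ascents n L j)"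

definition num_latin_squares :: "nat \<Rightarrow> nat \<Rightarrow> nat" where
  "num_latin_squares n m = card {L \<in> latin_squares n. total_ascents n L = m}"

text \<open>Since \<^const>\<open>card\<close> is 0 on infinite sets, this rules out a vacuous reading of the counts.\<close>

lemma finite_latin_squares: "finite (latin_squares n)"
  unfolding latin_squares_def by (simp add: finite_PiE)

end

theory Submission
  imports Defs "HOL-Number_Theory.Cong"
begin

text \<open>
  Count ascents between consecutive rows instead of along columns. Two consecutive rows are
  permutations of the same set that differ in every position, so below the entry 1 of the upper
  row there is a larger one, an ascent. As there are \<open>n - 1\<close> pairs of consecutive rows, a total of \<open>n\<close> means that one exceptional pair has two ascents and all other
  pairs have exactly one.

  A pair with exactly one ascent is rigid: the ascent is at the entry 1, so every entry \<open>v > 1\<close> goes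
  down, which forces 2 to go to 1, then 3 to 2, and so on, and leaves \<open>n\<close> as the successor of 1
  (\<open>single_ascent_steps\<close>). Hence the lower row is the upper one decremented cyclically, and
  \<open>L i j + i\<close> is constant modulo \<open>n\<close> above the exceptional pair as well as below it. A column
  therefore consists of two descending cyclic runs of total length \<open>n\<close> without a common value, and
  this is possible only if the second run continues the first (\<open>two_runs_join\<close>). So the
  exceptional pair is a cyclic decrement too and has just one ascent, a contradiction.

  The second value is dual to the first: replacing every entry \<open>v\<close> by \<open>n + 1 - v\<close> exchanges ascents
  and descents, hence the totals \<open>m\<close> and \<open>n (n - 1) - m\<close>, and
  \<open>(n - 1)\<^sup>2 - 1 = n (n - 1) - n\<close>.
\<close>

section \<open>Ascents by rows and complementation\<close>

text \<open>Dropping extensionality makes the class closed under complementing all entries.\<close>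

definition latin_array :: "nat \<Rightarrow> (nat \<Rightarrow> nat \<Rightarrow> nat) \<Rightarrow> bool" where
  "latin_array n L \<longleftrightarrow>
     (\<forall>i\<in>{1..n}. bij_betw (L i) {1..n} {1..n}) \<and>
     (\<forall>j\<in>{1..n}. inj_on (\<lambda>i. L i j) {1..n})"

definition row_ascents :: "nat \<Rightarrow> (nat \<Rightarrow> nat \<Rightarrow> nat) \<Rightarrow> nat \<Rightarrow> nat" where
  "row_ascents n L i = card {j \<in> {1..n}. L i j < L (i + 1) j}"

lemma latin_array_if_latin_square: "L \<in> latin_squares n \<Longrightarrow> latin_array n L"
  by (auto simp: latin_squares_def latin_array_def bij_betw_def)

lemma latin_array_entry:
  assumes "latin_array n L" "i \<in> {1..n}" "j \<in> {1..n}"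
  shows "1 \<le> L i j" "L i j \<le> n"
proof -
  have "bij_betw (L i) {1..n} {1..n}"
    using assms by (simp add: latin_array_def)
  then have "L i j \<in> {1..n}" using assms(3) by (rule bij_betwE[rule_format])
  then show "1 \<le> L i j" "L i j \<le> n" by auto
qed

lemma latin_array_column_eqD:
  assumes "latin_array n L" "j \<in> {1..n}" "i \<in> {1..n}" "i' \<in> {1..n}" "L i j = L i' j"
  shows "i = i'"
proof -
  have "inj_on (\<lambda>i. L i j) {1..n}" using assms(1,2) by (simp add: latin_array_def)
  then show ?thesis using assms(5,3,4) by (rule inj_onD)
qed

lemma latin_array_complement:
  assumes "latin_array n L"
  shows "latin_array n (\<lambda>i j. n + 1 - L i j)"
proof -
  have flip: "bij_betw (\<lambda>v. n + 1 - v) {1..n} {1..n}"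
    by (rule bij_betwI[where g = "\<lambda>v. n + 1 - v"]) auto
  have "bij_betw (\<lambda>j. n + 1 - L i j) {1..n} {1..n}" if "i \<in> {1..n}" for i
    using bij_betw_trans[OF _ flip, of "L i" "{1..n}"] assms that
    by (simp add: latin_array_def comp_def)
  moreover have "inj_on (\<lambda>i. n + 1 - L i j) {1..n}" if j: "j \<in> {1..n}" for j
  proof (rule inj_onI)
    fix i i' assume i: "i \<in> {1..n}" "i' \<in> {1..n}" and eq: "n + 1 - L i j = n + 1 - L i' j"
    have "L i j = L i' j"
      using eq latin_array_entry[OF assms i(1) j] latin_array_entry[OF assms i(2) j] by linarith
    then show "i = i'" by (rule latin_array_column_eqD[OF assms j i])
  qed
  ultimately show ?thesis by (simp add: latin_array_def)
qed

lemma total_ascents_by_rows: "total_ascents n L = (\<Sum>i = 1..n - 1. row_ascents n L i)"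
proof -
  have count: "card {x \<in> A. P x} = (\<Sum>x\<in>A. if P x then 1 else 0)"
    if "finite A" for A :: "nat set" and P
    unfolding card_eq_sum using that by (rule sum.inter_filter)
  have "total_ascents n L = (\<Sum>j = 1..n. \<Sum>i = 1..n - 1. if L i j < L (i + 1) j then 1 else 0)"
    unfolding total_ascents_def column_ascents_def by (simp only: count finite_atLeastAtMost)
  also have "\<dots> = (\<Sum>i = 1..n - 1. \<Sum>j = 1..n. if L i j < L (i + 1) j then 1 else 0)"
    by (rule sum.swap)
  also have "\<dots> = (\<Sum>i = 1..n - 1. row_ascents n L i)"
    unfolding row_ascents_def by (simp only: count finite_atLeastAtMost)
  finally show ?thesis .
qed

lemma total_ascents_complement:
  assumes L: "latin_array n L"
  shows "total_ascents n L + total_ascents n (\<lambda>i j. n + 1 - L i j) = n * (n - 1)"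
proof -
  have "column_ascents n L j + column_ascents n (\<lambda>i j. n + 1 - L i j) j = n - 1"
    if j: "j \<in> {1..n}" for j
  proof -
    let ?A = "{i \<in> {1..n - 1}. L i j < L (i + 1) j}"
    let ?D = "{i \<in> {1..n - 1}. n + 1 - L i j < n + 1 - L (i + 1) j}"
    have up_or_down: "n + 1 - L i j < n + 1 - L (i + 1) j \<longleftrightarrow> \<not> L i j < L (i + 1) j"
      if "i \<in> {1..n - 1}" for i
      using latin_array_entry[OF L, of i j] latin_array_entry[OF L, of "i + 1" j]
        latin_array_column_eqD[OF L, of j i "i + 1"] that j by fastforce
    have "?A \<union> ?D = {1..n - 1}" "?A \<inter> ?D = {}" using up_or_down by blast+
    then have "card ?A + card ?D = card {1..n - 1}"
      by (subst card_Un_disjoint[symmetric]) auto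
    then show ?thesis by (simp add: column_ascents_def)
  qed
  then show ?thesis by (simp add: total_ascents_def sum.distrib[symmetric])
qed

text \<open>The entry 1 can only go up.\<close>

lemma row_ascents_pos:
  assumes L: "latin_array n L" and i: "i \<in> {1..n - 1}"
  shows "row_ascents n L i \<ge> 1"
proof -
  have rows: "i \<in> {1..n}" "i + 1 \<in> {1..n}" using i by auto
  have "1 \<in> L i ` {1..n}"
    using L rows by (auto simp: latin_array_def bij_betw_def)
  then obtain j where j: "j \<in> {1..n}" "L i j = 1" by auto
  have "L (i + 1) j \<noteq> L i j"
    using latin_array_column_eqD[OF L j(1) rows] by auto
  then have "L i j < L (i + 1) j"
    using j latin_array_entry[OF L rows(2) j(1)] by linarith
  then have "{j \<in> {1..n}. L i j < L (i + 1) j} \<noteq> {}" using j by blast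
  then show ?thesis by (simp add: row_ascents_def Suc_le_eq card_gt_0_iff)
qed

section \<open>Row pairs with a single ascent\<close>

text \<open>The only way from one permutation to another with a single ascent and descents elsewhere
  is the cyclic decrement: the ascent is spent on the entry 1, and the other entries, taken in
  increasing order, each find only the value just below them free.\<close>

lemma single_ascent_steps:
  fixes f g :: "nat \<Rightarrow> nat"
  assumes f: "bij_betw f {1..n} {1..n}" and g: "bij_betw g {1..n} {1..n}"
    and ne: "\<And>j. j \<in> {1..n} \<Longrightarrow> f j \<noteq> g j"
    and one: "card {j \<in> {1..n}. f j < g j} = 1"
    and j: "j \<in> {1..n}"
  shows "f j = g j + 1 \<or> f j = 1 \<and> g j = n"
proof -
  have fim: "f ` {1..n} = {1..n}" and gim: "g ` {1..n} = {1..n}"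
    and ginj: "inj_on g {1..n}" using f g by (auto simp: bij_betw_def)
  obtain a where a: "{j \<in> {1..n}. f j < g j} = {a}"
    using one by (auto simp: card_1_singleton_iff)
  have range: "1 \<le> f j" "f j \<le> n" "1 \<le> g j" "g j \<le> n" if "j \<in> {1..n}" for j
    using that fim gim by (metis atLeastAtMost_iff imageI)+
  have down: "g j < f j" if "j \<in> {1..n}" "f j \<noteq> 1" for j
  proof -
    have "1 \<in> f ` {1..n}" unfolding fim using j by simp
    then obtain b where b: "b \<in> {1..n}" "f b = 1" by auto
    then have "f b < g b" using ne[of b] range[of b] by linarith
    then have "b = a" using a b by blast
    then have "\<not> f j < g j" using a b that by auto
    then show ?thesis using ne[OF that(1)] by linarith
  qed
  have dec: "f j = v \<Longrightarrow> v \<noteq> 1 \<Longrightarrow> j \<in> {1..n} \<Longrightarrow> f j = g j + 1" for v j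
  proof (induction v arbitrary: j rule: less_induct)
    case (less v)
    show ?case
    proof (rule ccontr)
      assume "f j \<noteq> g j + 1"
      then have lt: "g j + 1 < v" using down[of j] less.prems by simp
      then have "g j + 1 \<in> f ` {1..n}" using fim range[of j] less.prems by auto
      then obtain k where k: "k \<in> {1..n}" "f k = g j + 1" by auto
      have "f k = g k + 1"
        using less.IH[OF lt k(2) _ k(1)] range[of j] less.prems by auto
      then have "g k = g j" using k(2) by simp
      then have "k = j" using k(1) less.prems(3) by (rule inj_onD[OF ginj])
      then show False using k lt less.prems by simp
    qed
  qed
  show ?thesis
  proof (cases "f j = 1")
    case True
    have "n \<in> g ` {1..n}" unfolding gim using j by simp
    then obtain b where b: "b \<in> {1..n}" "g b = n" by blast
    have "g b \<ge> f b" using range(2)[OF b(1)] b(2) by simp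
    then have "f b = 1" using down[OF b(1)] by linarith
    then have "f b = f j" using True by simp
    then have "b = j" using b(1) j by (rule inj_onD[OF bij_betw_imp_inj_on[OF f]])
    then show ?thesis using b True by simp
  next
    case False
    then show ?thesis using dec j by blast
  qed
qed

lemma single_row_ascent_shift:
  assumes L: "latin_array n L" and i: "i \<in> {1..n - 1}" and one: "row_ascents n L i = 1"
    and j: "j \<in> {1..n}"
  shows "[L (i + 1) j + (i + 1) = L i j + i] (mod n)"
proof -
  have rows: "i \<in> {1..n}" "i + 1 \<in> {1..n}" using i by auto
  have "L i j = L (i + 1) j + 1 \<or> L i j = 1 \<and> L (i + 1) j = n"
  proof (rule single_ascent_steps[where f = "L i" and g = "L (i + 1)"])
    show "bij_betw (L i) {1..n} {1..n}" "bij_betw (L (i + 1)) {1..n} {1..n}"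
      using L rows unfolding latin_array_def by blast+
    show "L i j \<noteq> L (i + 1) j" if "j \<in> {1..n}" for j
      using latin_array_column_eqD[OF L that rows] by auto
    show "card {j \<in> {1..n}. L i j < L (i + 1) j} = 1" using one by (simp add: row_ascents_def)
  qed (fact j)
  then show ?thesis
  proof (elim disjE conjE)
    assume "L i j = 1" "L (i + 1) j = n"
    then have "L (i + 1) j + (i + 1) = n + (L i j + i)" by simp
    then show ?thesis by (simp only: cong_def mod_add_self1)
  qed simp
qed

section \<open>Columns made of two cyclic runs\<close>

text \<open>The values \<open>x i + i\<close> are constant modulo \<open>n\<close> precisely along a descending cyclic run. If the
  second of two such runs started off the continuation of the first by a residue \<open>d \<noteq> 0\<close>, then
  values at distance \<open>d\<close> in different runs would agree; as the runs together have length \<open>n\<close>,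
  positions at every distance from 1 to \<open>n - 1\<close> occur.\<close>

lemma two_runs_join:
  fixes x :: "nat \<Rightarrow> nat"
  assumes k: "k \<in> {1..n - 1}"
    and first: "\<And>i. i \<in> {1..k} \<Longrightarrow> [x i + i = u] (mod n)"
    and second: "\<And>i. i \<in> {k + 1..n} \<Longrightarrow> [x i + i = v] (mod n)"
    and distinct: "\<And>i i'. i \<in> {1..n} \<Longrightarrow> i' \<in> {1..n} \<Longrightarrow> [x i = x i'] (mod n) \<Longrightarrow> i = i'"
  shows "[u = v] (mod n)"
proof (rule ccontr)
  assume uv: "\<not> [u = v] (mod n)"
  have n: "n > 0" using k by auto
  define d where "d = (v + (n - u mod n)) mod n"
  have "(u + d) mod n = (u mod n + (v + (n - u mod n))) mod n"
    unfolding d_def by (metis mod_add_left_eq mod_add_right_eq)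
  also have "u mod n + (v + (n - u mod n)) = v + n"
    using mod_less_divisor[OF n, of u] by linarith
  finally have ud: "[u + d = v] (mod n)" by (simp add: cong_def)
  have d: "0 < d" "d < n"
    using uv ud n by (auto simp: d_def intro: gr0I)
  \<comment> \<open>The last position of the first run, unless \<open>d\<close> further on lies beyond the end.\<close>
  define i where "i = min k (n - d)"
  have i: "i \<in> {1..k}" "i + d \<in> {k + 1..n}"
    using d k by (auto simp: i_def min_def)
  have "[x (i + d) + (i + d) = v] (mod n)" by (rule second[OF i(2)])
  also have "[v = u + d] (mod n)" using ud by (rule cong_sym)
  also have "[u + d = (x i + i) + d] (mod n)"
    using first[OF i(1)] by (simp add: cong_sym cong_add_rcancel_nat)
  finally have "[x (i + d) + (i + d) = x i + (i + d)] (mod n)" by (simp add: add.assoc)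
  then have "[x (i + d) = x i] (mod n)" by (simp add: cong_add_rcancel_nat)
  then have "i + d = i" using distinct[of "i + d" i] i k by auto
  then show False using d by simp
qed

section \<open>The excluded totals\<close>

text \<open>The exceptional pair of rows with two ascents cannot exist: in every column the runs above
  and below it leave only the cyclic decrement as the step between them.\<close>

theorem total_ascents_neq_order:
  assumes L: "latin_array n L" and n: "n \<ge> 2"
  shows "total_ascents n L \<noteq> n"
proof
  assume total: "total_ascents n L = n"
  let ?r = "row_ascents n L"
  have pos: "?r i \<ge> 1" if "i \<in> {1..n - 1}" for i
    using row_ascents_pos[OF L that] .
  have "(\<Sum>i = 1..n - 1. ?r i - 1) = (\<Sum>i = 1..n - 1. ?r i) - (\<Sum>i = 1..n - 1. 1)"
    by (rule sum_subtractf_nat) (use pos in auto)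
  also have "\<dots> = 1" using total n by (simp add: total_ascents_by_rows)
  finally have "\<exists>k\<in>{1..n - 1}. ?r k - 1 = 1 \<and> (\<forall>i\<in>{1..n - 1}. k \<noteq> i \<longrightarrow> ?r i - 1 = 0)"
    by (subst (asm) sum_eq_1_iff) auto
  then obtain k where k: "k \<in> {1..n - 1}" "?r k - 1 = 1"
    and "\<forall>i\<in>{1..n - 1}. k \<noteq> i \<longrightarrow> ?r i - 1 = 0"
    by blast
  then have others: "?r i = 1" if "i \<in> {1..n - 1}" "i \<noteq> k" for i
    using pos[of i] that by fastforce
  have shift: "[L (i + 1) j + (i + 1) = L i j + i] (mod n)"
    if "j \<in> {1..n}" "i \<in> {1..n - 1}" "i \<noteq> k" for i j
    using single_row_ascent_shift[OF L that(2) others that(1)] that by blast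
  have join: "[L (k + 1) j + 1 = L k j] (mod n)" if j: "j \<in> {1..n}" for j
  proof -
    have first: "[L i j + i = L 1 j + 1] (mod n)" if "i \<in> {1..k}" for i
    proof -
      have "1 \<le> i" using that by simp
      then have "i \<le> k \<longrightarrow> [L i j + i = L 1 j + 1] (mod n)"
      proof (induction i rule: dec_induct)
        case (step i)
        then show ?case using shift[OF j, of i] k by (auto intro: cong_trans)
      qed simp
      then show ?thesis using that by simp
    qed
    have second: "[L i j + i = L (k + 1) j + (k + 1)] (mod n)" if "i \<in> {k + 1..n}" for i
    proof -
      have "k + 1 \<le> i" using that by simp
      then have "i \<le> n \<longrightarrow> [L i j + i = L (k + 1) j + (k + 1)] (mod n)"
      proof (induction i rule: dec_induct)
        case (step i)
        then have "Suc i \<le> n \<Longrightarrow> i \<in> {1..n - 1} \<and> i \<noteq> k" by auto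
        with step show ?case using shift[OF j, of i] by (auto intro: cong_trans)
      qed simp
      then show ?thesis using that by simp
    qed
    have "[L 1 j + 1 = L (k + 1) j + (k + 1)] (mod n)"
    proof (rule two_runs_join[where x = "\<lambda>i. L i j", OF k(1) first second])
      fix i i' assume i: "i \<in> {1..n}" "i' \<in> {1..n}" and cong: "[L i j = L i' j] (mod n)"
      \<comment> \<open>Subtracting 1 moves the entries into the residue range below \<open>n\<close>.\<close>
      have "[L i j - 1 = L i' j - 1] (mod n)"
        using cong latin_array_entry[OF L i(1) j] latin_array_entry[OF L i(2) j]
        by (intro cong_diff_nat) auto
      then have "L i j - 1 = L i' j - 1"
        using latin_array_entry[OF L i(1) j] latin_array_entry[OF L i(2) j]
        by (intro cong_less_modulus_unique_nat) auto
      then show "i = i'"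
        using latin_array_column_eqD[OF L j i] latin_array_entry[OF L i(1) j]
          latin_array_entry[OF L i(2) j] by simp
    qed auto
    then have "[L (k + 1) j + (k + 1) = L k j + k] (mod n)"
      using first[of k] k by (auto intro: cong_trans cong_sym)
    then have "[(L (k + 1) j + 1) + k = L k j + k] (mod n)" by (simp add: ac_simps)
    then show ?thesis by (simp only: cong_add_rcancel_nat)
  qed
  have rows: "k \<in> {1..n}" "k + 1 \<in> {1..n}" using k by auto
  \<comment> \<open>A cyclic decrement goes up only where it wraps around.\<close>
  have ascent_at_1: "L k j = 1" if j: "j \<in> {1..n}" and up: "L k j < L (k + 1) j" for j
  proof -
    have "n dvd (L (k + 1) j + 1) - L k j"
      using join[OF j] up by (simp add: cong_altdef_nat)
    then have "n \<le> (L (k + 1) j + 1) - L k j"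
      using up by (intro dvd_imp_le) auto
    then show ?thesis
      using latin_array_entry[OF L rows(1) j] latin_array_entry[OF L rows(2) j] by linarith
  qed
  have "?r k \<le> 1"
    unfolding row_ascents_def
  proof -
    let ?A = "{j \<in> {1..n}. L k j < L (k + 1) j}"
    have "inj_on (L k) {1..n}"
      using L rows(1) unfolding latin_array_def by (blast intro: bij_betw_imp_inj_on)
    then have "inj_on (L k) ?A" by (rule inj_on_subset) blast
    moreover have "L k ` ?A \<subseteq> {1}" using ascent_at_1 by blast
    ultimately have "card ?A \<le> card {1::nat}" by (rule card_inj_on_le) simp
    then show "card ?A \<le> 1" by simp
  qed
  then show False using k by simp
qed

theorem theorem4p4:
  fixes n :: nat
  assumes "n \<ge> 3"
  shows "num_latin_squares n n = 0 \<and> num_latin_squares n ((n - 1)^2 - 1) = 0"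
proof -
  have low: "total_ascents n L \<noteq> n" if "L \<in> latin_squares n" for L
    using total_ascents_neq_order latin_array_if_latin_square[OF that] assms by simp
  have high: "total_ascents n L \<noteq> (n - 1)^2 - 1" if "L \<in> latin_squares n" for L
  proof
    assume top: "total_ascents n L = (n - 1)^2 - 1"
    have L: "latin_array n L" using that by (rule latin_array_if_latin_square)
    obtain m where m: "n = m + 2" using assms le_Suc_ex[of 2 n] by auto
    have "n * (n - 1) = ((n - 1)^2 - 1) + n"
      by (simp add: m power2_eq_square algebra_simps)
    then have "total_ascents n (\<lambda>i j. n + 1 - L i j) = n"
      using total_ascents_complement[OF L] top by linarith
    then show False
      using total_ascents_neq_order[OF latin_array_complement[OF L]] assms by simp
  qed
  have "{L \<in> latin_squares n. total_ascents n L = n} = {}"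
    "{L \<in> latin_squares n. total_ascents n L = (n - 1)^2 - 1} = {}"
    using low high by blast+
  then show ?thesis by (simp only: num_latin_squares_def card.empty)
qed

end
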